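(* Let $n,k$ be integers with $2\le k\le n/2$. A regular $n$-gon admits a non-trivial infinitesimal deformation as a bicycle $(n,k)$-gon if and only if $$\tan\left(kr\frac{\pi}{n}\right)\tan\left(\frac{\pi}{n}\right)=\tan\left(k\frac{\pi}{n}\right)\tan\left(r\frac{\pi}{n}\right)$$ for some integer $r$ with $2\le r\le n-2$.
   Context: A plane $n$-gon with consecutive vertices $V_0,\dots,V_{n-1}$ (indices modulo $n$) is a bicycle $(n,k)$-gon, $2\le k\le n/2$, if all its sides $V_iV_{i+1}$ have equal lengths and all its $k$-diagonals $V_iV_{i+k}$ have equal lengths. Let $V_i=(\cos(2\pi i/n),\sin(2\pi i/n))$ be the vertices of a regular $n$-gon. An infinitesimal deformation of it as a bicycle $(n,k)$-gon is a collection of vectors $U_0,\dots,U_{n-1}\in\mathbf{R}^2$ such that, modulo $\varepsilon^2$, the polygon with vertices $V_i+\varepsilon U_i$ has the same side lengths as the original polygon and all its $k$-diagonals are equal to each other; that is, $(V_{i+1}-V_i)\cdot(U_{i+1}-U_i)=0$ for all $i$, and $(V_{i+k}-V_i)\cdot(U_{i+k}-U_i)=c$ for all $i$ with some constant $c$ independent of $i$. The deformation is trivial if it is induced by an infinitesimal isometry of the plane (a combination of infinitesimal translations and an infinitesimal rotation), and non-trivial otherwise. The equation with tangents is understood with infinite values allowed on both sides, i.e. as $$\sin\tfrac{kr\pi}{n}\,\sin\tfrac{\pi}{n}\,\cos\tfrac{k\pi}{n}\,\cos\tfrac{r\pi}{n}=\cos\tfrac{kr\pi}{n}\,\cos\tfrac{\pi}{n}\,\sin\tfrac{k\pi}{n}\,\sin\tfrac{r\pi}{n}.$$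 *)

theory Defs
  imports "HOL-Analysis.Analysis"
begin

text \<open>An \<open>n\<close>-gon is a function \<open>nat \<Rightarrow> real ^ 2\<close> of which only the values at the indices
  below \<open>n\<close> matter; cyclic successors are written with \<open>mod n\<close>. The same convention applies to
  the velocity vectors of a deformation.\<close>

definition regular_polygon :: "nat \<Rightarrow> nat \<Rightarrow> real ^ 2" where
  "regular_polygon n i = vector [cos (2 * pi * real i / real n), sin (2 * pi * real i / real n)]"

text \<open>Here \<open>V\<close> is meant to be a bicycle \<open>(n,k)\<close>-gon already. Modulo \<open>\<epsilon>\<^sup>2\<close>, the
  polygon with vertices \<open>V i + \<epsilon> *\<^sub>R U i\<close> then has the side lengths of \<open>V\<close>, and its \<open>k\<close>-diagonals
  are equal to each other; their common length may vary, so \<open>c\<close> need not be zero.\<close>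

definition bicycle_inf_deformation ::
  "nat \<Rightarrow> nat \<Rightarrow> (nat \<Rightarrow> real ^ 2) \<Rightarrow> (nat \<Rightarrow> real ^ 2) \<Rightarrow> bool" where
  "bicycle_inf_deformation n k V U \<longleftrightarrow>
     (\<forall>i<n. (V ((i + 1) mod n) - V i) \<bullet> (U ((i + 1) mod n) - U i) = 0) \<and>
     (\<exists>c. \<forall>i<n. (V ((i + k) mod n) - V i) \<bullet> (U ((i + k) mod n) - U i) = c)"

text \<open>The velocity field of an infinitesimal isometry of the plane: a translation by \<open>a\<close> combined
  with a rotation of angular velocity \<open>w\<close> about the origin.\<close>

definition inf_isometry :: "(real ^ 2 \<Rightarrow> real ^ 2) \<Rightarrow> bool" where
  "inf_isometry X \<longleftrightarrow> (\<exists>a w. \<forall>x. X x = a + w *\<^sub>R vector [- (x $ 2), x $ 1])"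

definition trivial_inf_deformation ::
  "nat \<Rightarrow> (nat \<Rightarrow> real ^ 2) \<Rightarrow> (nat \<Rightarrow> real ^ 2) \<Rightarrow> bool" where
  "trivial_inf_deformation n V U \<longleftrightarrow> (\<exists>X. inf_isometry X \<and> (\<forall>i<n. U i = X (V i)))"

end

theory Submission
  imports Defs
begin

text \<open>Write \<open>U j = x j V j + y j J V j\<close>, where \<open>J\<close> is the rotation by a right angle. Up to the
  factor \<open>2 sin (m \<pi>/n)\<close>, the derivative of half the squared length of the \<open>m\<close>-diagonal at \<open>j\<close> is
  \<open>sin (m \<pi>/n) (x (j+m) + x j) + cos (m \<pi>/n) (y (j+m) - y j)\<close>, which is invariant under cyclic
  shifts. The discrete Fourier transform therefore splits the conditions for \<open>m = 1\<close> and
  \<open>m = k\<close> into one \<open>2 \<times> 2\<close> linear system per frequency \<open>r\<close>, whose determinant vanishes exactly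
  when the tangent equation holds for \<open>r\<close>. The frequency \<open>0\<close> carries the rotation and the
  frequencies \<open>\<plusminus>1\<close> carry the translations.\<close>

section \<open>Polar velocity fields and rates of chord lengths\<close>

definition polar_field :: "nat \<Rightarrow> (nat \<Rightarrow> real) \<Rightarrow> (nat \<Rightarrow> real) \<Rightarrow> nat \<Rightarrow> real ^ 2" where
  "polar_field n x y i = x i *\<^sub>R regular_polygon n i +
     y i *\<^sub>R vector [- (regular_polygon n i $ 2), regular_polygon n i $ 1]"

text \<open>The index \<open>i + m\<close> is left unreduced, so \<open>x\<close> and
  \<open>y\<close> have to be extended \<open>n\<close>-periodically; the lemmas tying this rate to
  the polygon or to its transform require this as \<open>x (i mod n) = x i\<close>.\<close>

definition chord_rate :: "nat \<Rightarrow> (nat \<Rightarrow> real) \<Rightarrow> (nat \<Rightarrow> real) \<Rightarrow> nat \<Rightarrow> nat \<Rightarrow> real" where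
  "chord_rate n x y m i = sin (real m * pi / real n) * (x (i + m) + x i) +
     cos (real m * pi / real n) * (y (i + m) - y i)"

lemma regular_polygon_nth [simp]:
  "regular_polygon n i $ 1 = cos (2 * pi * real i / real n)"
  "regular_polygon n i $ 2 = sin (2 * pi * real i / real n)"
  by (simp_all add: regular_polygon_def)

lemma cis_cong_2pi:
  assumes "a = b + 2 * pi * of_int m"
  shows "cis a = cis b"
  by (simp add: assms cis_multiple_2pi flip: cis_mult)

lemma cis_eq_mod:
  assumes "n > 0"
  shows "cis (2 * pi * real (i mod n) / real n) = cis (2 * pi * real i / real n)"
proof -
  have "real i = real (i div n) * real n + real (i mod n)"
    by (metis div_mult_mod_eq of_nat_add of_nat_mult)
  then have "2 * pi * real i / real n = 2 * pi * real (i mod n) / real n + 2 * pi * of_int (int (i div n))"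
    using assms by (simp add: field_simps)
  then show ?thesis
    by (rule cis_cong_2pi[symmetric])
qed

lemma regular_polygon_mod:
  assumes "n > 0"
  shows "regular_polygon n (i mod n) = regular_polygon n i"
  using cis_eq_mod[OF assms, of i] by (simp add: regular_polygon_def complex_eq_iff)

text \<open>For unit vectors \<open>P\<close>, \<open>Q\<close> at the angles \<open>a\<close>,
  \<open>b\<close> and the right-angle rotation \<open>J\<close>, one has
  \<open>P \<bullet> Q = cos d\<close>, \<open>Q \<bullet> J P = sin d\<close> and
  \<open>P \<bullet> J Q = - sin d\<close>; the expansion involves nothing else beyond
  \<open>P \<bullet> P = Q \<bullet> Q = 1\<close> and
  \<open>P \<bullet> J P = Q \<bullet> J Q = 0\<close>.\<close>

lemma inner_polar_chord:
  fixes a d x y x' y' :: real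
  assumes "d = b - a"
  shows "((vector [cos b, sin b] :: real ^ 2) - vector [cos a, sin a]) \<bullet>
     ((x' *\<^sub>R vector [cos b, sin b] + y' *\<^sub>R vector [- sin b, cos b]) -
      (x *\<^sub>R vector [cos a, sin a] + y *\<^sub>R vector [- sin a, cos a])) =
     (1 - cos d) * (x' + x) + sin d * (y' - y)"
proof -
  have "(sin a)\<^sup>2 = 1 - (cos a)\<^sup>2" "(sin b)\<^sup>2 = 1 - (cos b)\<^sup>2"
    by (simp_all add: sin_squared_eq)
  then show ?thesis
    by (simp add: assms inner_vec_def sum_2 cos_diff sin_diff) algebra
qed

lemma inner_polar_field_chord:
  assumes "n > 0" and "\<And>i. x (i mod n) = x i" and "\<And>i. y (i mod n) = y i"
    and U: "\<And>i. i < n \<Longrightarrow> U i = polar_field n x y i" and "i < n"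
  shows "(regular_polygon n ((i + m) mod n) - regular_polygon n i) \<bullet> (U ((i + m) mod n) - U i) =
    2 * sin (real m * pi / real n) * chord_rate n x y m i"
proof -
  \<comment> \<open>Half the central angle of the \<open>m\<close>-diagonal, so that the
    double-angle formulas split off the factor \<open>2 * sin h\<close>.\<close>
  define h where "h = real m * pi / real n"
  have "(regular_polygon n ((i + m) mod n) - regular_polygon n i) \<bullet> (U ((i + m) mod n) - U i) =
      (regular_polygon n (i + m) - regular_polygon n i) \<bullet>
        (polar_field n x y (i + m) - polar_field n x y i)"
    using assms by (simp add: polar_field_def regular_polygon_mod del: regular_polygon_nth)
  also have "\<dots> = (1 - cos (2 * h)) * (x (i + m) + x i) + sin (2 * h) * (y (i + m) - y i)"
    unfolding polar_field_def regular_polygon_nth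
    unfolding regular_polygon_def
    by (rule inner_polar_chord) (use \<open>n > 0\<close> in \<open>simp add: h_def field_simps\<close>)
  also have "\<dots> = 2 * sin h * chord_rate n x y m i"
    unfolding chord_rate_def h_def[symmetric]
    unfolding cos_double_sin sin_double power2_eq_square by (simp add: algebra_simps)
  finally show ?thesis
    by (simp add: h_def)
qed

text \<open>The factor \<open>2 * sin (m * pi / n)\<close> does not depend on \<open>i\<close> and
  is positive for \<open>0 < m < n\<close>; dividing by it preserves both vanishing and constancy
  along the polygon.\<close>

lemma bicycle_inf_deformation_regular_iff:
  assumes "2 \<le> n" "0 < k" "k < n"
    and "\<And>i. x (i mod n) = x i" and "\<And>i. y (i mod n) = y i"
    and U: "\<And>i. i < n \<Longrightarrow> U i = polar_field n x y i"
  shows "bicycle_inf_deformation n k (regular_polygon n) U \<longleftrightarrow>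
    (\<forall>i<n. chord_rate n x y 1 i = 0) \<and> (\<exists>c. \<forall>i<n. chord_rate n x y k i = c)"
proof -
  have pos: "sin (real m * pi / real n) > 0" if "0 < m" "m < n" for m
    using that assms(1) by (intro sin_gt_zero) (auto simp: field_simps)
  have chord: "(regular_polygon n ((i + m) mod n) - regular_polygon n i) \<bullet>
      (U ((i + m) mod n) - U i) = 2 * sin (real m * pi / real n) * chord_rate n x y m i"
    if "i < n" for i m
    using assms that by (intro inner_polar_field_chord) auto
  have "(\<exists>c. \<forall>i<n. 2 * sin (real k * pi / real n) * chord_rate n x y k i = c) \<longleftrightarrow>
      (\<exists>c. \<forall>i<n. chord_rate n x y k i = c)"
  proof
    assume "\<exists>c. \<forall>i<n. 2 * sin (real k * pi / real n) * chord_rate n x y k i = c"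
    then obtain c where "\<And>i. i < n \<Longrightarrow> 2 * sin (real k * pi / real n) * chord_rate n x y k i = c"
      by blast
    then have "\<forall>i<n. chord_rate n x y k i = c / (2 * sin (real k * pi / real n))"
      using pos[of k] assms by (auto simp: field_simps)
    then show "\<exists>c. \<forall>i<n. chord_rate n x y k i = c" by blast
  qed auto
  moreover have "(\<forall>i<n. 2 * sin (real 1 * pi / real n) * chord_rate n x y 1 i = 0) \<longleftrightarrow>
      (\<forall>i<n. chord_rate n x y 1 i = 0)"
    using pos[of 1] assms by auto
  ultimately show ?thesis
    unfolding bicycle_inf_deformation_def by (simp only: chord cong: conj_cong imp_cong)
qed

section \<open>The discrete Fourier transform and its action on chord rates\<close>

definition dft :: "nat \<Rightarrow> (nat \<Rightarrow> real) \<Rightarrow> int \<Rightarrow> complex" where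
  "dft n x r = (\<Sum>j<n. complex_of_real (x j) * cis (- (2 * pi * of_int r * real j / real n)))"

text \<open>A geometric sum over the powers of an \<open>n\<close>-th root of unity
  \<open>w\<close>: it vanishes since \<open>w ^ n = 1\<close>, unless \<open>w = 1\<close>.\<close>

lemma sum_cis_roots:
  assumes "n > 0"
  shows "(\<Sum>j<n. cis (2 * pi * of_int r * real j / real n)) = (if int n dvd r then of_nat n else 0)"
proof -
  define w where "w = cis (2 * pi * of_int r / real n)"
  have pow: "w ^ j = cis (2 * pi * of_int r * real j / real n)" for j
    unfolding w_def Complex.DeMoivre by (rule arg_cong[where f = cis]) simp
  have "w ^ n = 1"
    using assms by (simp add: pow cis_multiple_2pi)
  moreover have "w = 1 \<longleftrightarrow> int n dvd r"
  proof
    assume "w = 1"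
    then have "cos (2 * pi * of_int r / real n) = 1"
      by (simp add: w_def complex_eq_iff)
    then obtain q :: int where "2 * pi * of_int r / real n = of_int q * 2 * pi"
      by (auto simp: cos_one_2pi_int)
    then have "of_int r = of_int q * real n"
      using assms by (simp add: field_simps)
    then have "r = q * int n"
      by (metis of_int_eq_iff of_int_mult of_int_of_nat_eq)
    then show "int n dvd r" by simp
  next
    assume "int n dvd r"
    then obtain q where "r = int n * q" ..
    then have "2 * pi * of_int r / real n = 0 + 2 * pi * of_int q"
      using assms by simp
    then have "w = cis 0"
      unfolding w_def by (rule cis_cong_2pi)
    then show "w = 1" by simp
  qed
  ultimately show ?thesis
    by (auto simp: geometric_sum simp flip: pow)
qed

text \<open>Raising the shift by one trades the term \<open>g m\<close> for the equal term
  \<open>g (m + n)\<close>.\<close>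

lemma sum_periodic_shift:
  fixes g :: "nat \<Rightarrow> 'a :: ab_group_add"
  assumes "\<And>i. g (i + n) = g i"
  shows "(\<Sum>j<n. g (j + m)) = (\<Sum>j<n. g j)"
proof (induction m)
  case (Suc m)
  have "(\<Sum>j<n. g (Suc j + m)) + g m = (\<Sum>j<Suc n. g (j + m))"
    by (subst sum.lessThan_Suc_shift) simp
  then have "(\<Sum>j<n. g (Suc j + m)) = (\<Sum>j<n. g (j + m))"
    using assms[of m] by (simp add: add.commute)
  then show ?case
    using Suc by simp
qed simp

text \<open>The whole summand of the transform is \<open>n\<close>-periodic, so reindexing absorbs
  the shift and leaves a phase.\<close>

lemma dft_shift:
  assumes "n > 0" and "\<And>i. x (i mod n) = x i"
  shows "dft n (\<lambda>j. x (j + m)) r = cis (2 * pi * of_int r * real m / real n) * dft n x r"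
proof -
  define g where "g j = complex_of_real (x j) * cis (- (2 * pi * of_int r * real j / real n))" for j
  have "g (i + n) = g i" for i
  proof -
    have "- (2 * pi * of_int r * real (i + n) / real n) =
        - (2 * pi * of_int r * real i / real n) + 2 * pi * of_int (- r)"
      using assms(1) by (simp add: field_simps)
    then have "cis (- (2 * pi * of_int r * real (i + n) / real n)) =
        cis (- (2 * pi * of_int r * real i / real n))"
      by (rule cis_cong_2pi)
    moreover have "x (i + n) = x i"
      using assms(2)[of "i + n"] assms(2)[of i] by simp
    ultimately show ?thesis by (simp only: g_def)
  qed
  then have "(\<Sum>j<n. g (j + m)) = dft n x r"
    by (subst sum_periodic_shift) (auto simp: dft_def g_def)
  moreover have "complex_of_real (x (j + m)) * cis (- (2 * pi * of_int r * real j / real n)) =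
      cis (2 * pi * of_int r * real m / real n) * g (j + m)" for j
    by (simp add: g_def mult.left_commute cis_mult add_divide_distrib distrib_left)
  ultimately show ?thesis
    unfolding dft_def[of n "\<lambda>j. x (j + m)"] by (simp flip: sum_distrib_left)
qed

lemma dft_inversion:
  assumes "i < n"
  shows "(\<Sum>r<n. dft n x (int r) * cis (2 * pi * real r * real i / real n)) = of_nat n * of_real (x i)"
proof -
  have "(\<Sum>r<n. dft n x (int r) * cis (2 * pi * real r * real i / real n)) =
      (\<Sum>r<n. \<Sum>j<n. of_real (x j) * cis (2 * pi * of_int (int i - int j) * real r / real n))"
    unfolding dft_def sum_distrib_right mult.assoc cis_mult
    by (intro sum.cong refl arg_cong2[where f = times] arg_cong[where f = cis])
      (simp add: algebra_simps diff_divide_distrib)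
  also have "\<dots> = (\<Sum>j<n. of_real (x j) *
      (\<Sum>r<n. cis (2 * pi * of_int (int i - int j) * real r / real n)))"
    by (subst sum.swap) (simp add: sum_distrib_left)
  also have "\<dots> = (\<Sum>j<n. of_real (x j) * (if j = i then of_nat n else 0))"
  proof (intro sum.cong refl)
    fix j assume "j \<in> {..<n}"
    \<comment> \<open>Two indices below \<open>n\<close> differ by less than \<open>n\<close>, so
      orthogonality keeps only the term \<open>j = i\<close>.\<close>
    then have "int n dvd (int i - int j) \<longleftrightarrow> j = i"
      using assms dvd_imp_le_int[of "int i - int j" "int n"] by force
    then show "of_real (x j) * (\<Sum>r<n. cis (2 * pi * of_int (int i - int j) * real r / real n)) =
        complex_of_real (x j) * (if j = i then of_nat n else 0)"
      using assms by (subst sum_cis_roots) auto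
  qed
  also have "\<dots> = of_nat n * of_real (x i)"
    using assms by (simp add: if_distrib cong: if_cong)
  finally show ?thesis .
qed

text \<open>This removes the unknown common rate of the \<open>k\<close>-diagonals from every
  frequency not divisible by \<open>n\<close>.\<close>

lemma dft_const:
  assumes "n > 0" "\<not> int n dvd r"
  shows "dft n (\<lambda>_. c) r = 0"
proof -
  have "dft n (\<lambda>_. c) r = of_real c * (\<Sum>j<n. cis (2 * pi * of_int (- r) * real j / real n))"
    by (simp add: dft_def sum_distrib_left)
  also have "\<dots> = 0"
    using assms by (subst sum_cis_roots) auto
  finally show ?thesis .
qed

lemma dft_conj:
  assumes "n > 0"
  shows "dft n x (int n - r) = cnj (dft n x r)"
proof -
  have "cis (- (2 * pi * of_int (int n - r) * real j / real n)) =
      cis (2 * pi * of_int r * real j / real n)" for j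
  proof -
    have "- (2 * pi * of_int (int n - r) * real j / real n) =
        2 * pi * of_int r * real j / real n + 2 * pi * of_int (- int j)"
      using assms by (simp add: field_simps)
    then show ?thesis
      by (rule cis_cong_2pi)
  qed
  then show ?thesis
    by (simp add: dft_def cis_cnj)
qed

text \<open>A shift by \<open>m\<close> multiplies the transform by \<open>cis (2 * t)\<close>, and
  \<open>cis (2 * t) + 1\<close> and \<open>cis (2 * t) - 1\<close> share the nonzero factor
  \<open>2 * cis t\<close>. What remains is one row of the linear system for frequency
  \<open>r\<close>.\<close>

lemma dft_chord_rate:
  assumes "n > 0" and "\<And>i. x (i mod n) = x i" and "\<And>i. y (i mod n) = y i"
    and h: "h = real m * pi / real n" and t: "t = real m * of_int r * pi / real n"
  shows "dft n (chord_rate n x y m) r =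
    2 * cis t * (of_real (sin h * cos t) * dft n x r + \<i> * of_real (cos h * sin t) * dft n y r)"
proof -
  have "dft n (chord_rate n x y m) r =
      of_real (sin h) * (dft n (\<lambda>j. x (j + m)) r + dft n x r) +
      of_real (cos h) * (dft n (\<lambda>j. y (j + m)) r - dft n y r)"
    unfolding chord_rate_def dft_def h
    by (simp add: sum_distrib_left sum.distrib sum_subtractf algebra_simps)
  also have "\<dots> = of_real (sin h) * (cis (2 * t) + 1) * dft n x r +
      of_real (cos h) * (cis (2 * t) - 1) * dft n y r"
    using assms by (subst (1 2) dft_shift) (auto simp: algebra_simps)
  also have "cis (2 * t) + 1 = 2 * cis t * of_real (cos t)"
    by (simp add: complex_eq_iff cos_double_cos sin_double power2_eq_square)
  also have "cis (2 * t) - 1 = 2 * cis t * \<i> * of_real (sin t)"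
    by (simp add: complex_eq_iff cos_double_sin sin_double power2_eq_square)
  finally show ?thesis
    by (simp add: algebra_simps)
qed

section \<open>Trivial deformations\<close>

text \<open>By inversion only the frequencies 0, 1 and \<open>n - 1\<close> survive. At frequency 0
  only a constant in \<open>y\<close> is left, which is a rotation; at frequency 1 the hypothesis
  couples \<open>x\<close> and \<open>y\<close> like the two components of a translation.\<close>

lemma trivial_of_dft:
  assumes "n \<ge> 4"
    and U: "\<And>i. i < n \<Longrightarrow> U i = polar_field n x y i"
    and mid: "\<And>r. \<lbrakk>2 \<le> r; r \<le> int n - 2\<rbrakk> \<Longrightarrow> dft n x r = 0 \<and> dft n y r = 0"
    and zero: "dft n x 0 = 0" and one: "dft n y 1 = \<i> * dft n x 1"
  shows "trivial_inf_deformation n (regular_polygon n) U"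
proof -
  define A where "A = dft n x 1"
  define w where "w = Re (dft n y 0) / n"
  \<comment> \<open>A translation by \<open>v\<close> has radial part
    \<open>v $ 1 * cos + v $ 2 * sin\<close>; matching it with \<open>2 / n\<close> times the real
    part of \<open>A * cis\<close> gives the conjugate of \<open>A\<close>, scaled by
    \<open>2 / n\<close>, as \<open>v\<close>.\<close>
  define X :: "real ^ 2 \<Rightarrow> real ^ 2" where
    "X v = vector [2 / n * Re A, - (2 / n * Im A)] + w *\<^sub>R vector [- (v $ 2), v $ 1]" for v
  have real: "dft n y 0 = of_real (Re (dft n y 0))"
    by (simp add: dft_def complex_eq_iff)
  have expand: "n * z i = Re (dft n z 0) + 2 * Re (dft n z 1 * cis (2 * pi * real i / real n))"
    if "i < n" and z: "\<And>r. \<lbrakk>2 \<le> r; r \<le> int n - 2\<rbrakk> \<Longrightarrow> dft n z r = 0"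
    for z :: "nat \<Rightarrow> real" and i
  proof -
    let ?g = "\<lambda>r. dft n z (int r) * cis (2 * pi * real r * real i / real n)"
    \<comment> \<open>Index \<open>n - 1\<close> acts as frequency -1, so its term is conjugate to
      that of frequency 1 and both together give twice a real part.\<close>
    have "cis (2 * pi * real (n - 1) * real i / real n) = cnj (cis (2 * pi * real i / real n))"
    proof -
      have "2 * pi * real (n - 1) * real i / real n =
          - (2 * pi * real i / real n) + 2 * pi * of_int (int i)"
        using assms(1) by (simp add: of_nat_diff field_simps)
      then show ?thesis
        unfolding cis_cnj by (rule cis_cong_2pi)
    qed
    moreover have "dft n z (int (n - 1)) = cnj (dft n z 1)"
      using dft_conj[of n z 1] assms(1) by (simp add: of_nat_diff)
    ultimately have last: "?g (n - 1) = cnj (dft n z 1 * cis (2 * pi * real i / real n))"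
      by simp
    have "of_nat n * complex_of_real (z i) = sum ?g {..<n}"
      using dft_inversion[OF \<open>i < n\<close>, of z] by simp
    also have "\<dots> = sum ?g {0, 1, n - 1}"
    proof (rule sum.mono_neutral_right)
      show "\<forall>r\<in>{..<n} - {0, 1, n - 1}. ?g r = 0"
      proof
        fix r assume "r \<in> {..<n} - {0, 1, n - 1}"
        then have "2 \<le> int r" "int r \<le> int n - 2" by auto
        then show "?g r = 0" using z by simp
      qed
    qed (use assms(1) in auto)
    also have "\<dots> = ?g 0 + ?g 1 + ?g (n - 1)"
      using assms(1) by (simp add: add.assoc)
    finally have "Re (of_nat n * complex_of_real (z i)) = Re (?g 0 + ?g 1 + ?g (n - 1))"
      by (rule arg_cong)
    then show ?thesis
      unfolding last by simp
  qed
  have "U i = X (regular_polygon n i)" if "i < n" for i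
  proof -
    define c s where "c = cos (2 * pi * real i / real n)" and "s = sin (2 * pi * real i / real n)"
    have x: "x i = 2 / n * (Re A * c - Im A * s)"
      using expand[OF that, of x] mid assms(1)
      by (simp add: zero A_def c_def s_def field_simps)
    have y: "y i = w - 2 / n * (Re A * s + Im A * c)"
      using expand[OF that, of y] mid assms(1)
      by (simp add: one A_def w_def c_def s_def field_simps)
    have "c * c + s * s = 1"
      by (simp add: c_def s_def flip: power2_eq_square)
    moreover have "U i = x i *\<^sub>R vector [c, s] + y i *\<^sub>R vector [- s, c]"
      using U[OF that] unfolding polar_field_def by (simp add: regular_polygon_def c_def s_def)
    ultimately show ?thesis
      unfolding X_def regular_polygon_nth c_def[symmetric] s_def[symmetric] x y
      by (simp add: vec_eq_iff forall_2) algebra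
  qed
  moreover have "inf_isometry X"
    unfolding inf_isometry_def X_def by blast
  ultimately show ?thesis
    unfolding trivial_inf_deformation_def by blast
qed

text \<open>A rotation has no radial part and a translation contributes its projection onto the
  vertex. A radial part that is not a first harmonic thus certifies non-triviality.\<close>

lemma trivial_polar_field_radial:
  assumes "trivial_inf_deformation n (regular_polygon n) (polar_field n x y)"
  obtains a b where
    "\<And>i. i < n \<Longrightarrow> x i = a * cos (2 * pi * real i / real n) + b * sin (2 * pi * real i / real n)"
proof -
  from assms obtain v w where vw: "\<And>i. i < n \<Longrightarrow> polar_field n x y i =
      v + w *\<^sub>R vector [- (regular_polygon n i $ 2), regular_polygon n i $ 1]"
    unfolding trivial_inf_deformation_def inf_isometry_def by metis
  have "x i = v $ 1 * cos (2 * pi * real i / real n) + v $ 2 * sin (2 * pi * real i / real n)"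
    if "i < n" for i
  proof -
    define c s where "c = cos (2 * pi * real i / real n)" and "s = sin (2 * pi * real i / real n)"
    have "c * c + s * s = 1"
      by (simp add: c_def s_def flip: power2_eq_square)
    moreover have "x i * c - y i * s = v $ 1 - w * s" "x i * s + y i * c = v $ 2 + w * c"
      using vw[OF that] by (simp_all add: polar_field_def vec_eq_iff forall_2 c_def s_def)
    ultimately have "x i = v $ 1 * c + v $ 2 * s"
      by algebra
    then show ?thesis by (simp add: c_def s_def)
  qed
  then show ?thesis using that by blast
qed

section \<open>The two directions of the criterion\<close>

lemma trivial_of_determinants_nonzero:
  fixes n k :: nat
  assumes "4 \<le> n" "0 < k" "k < n"
    and def: "bicycle_inf_deformation n k (regular_polygon n) U"
    and det: "\<And>r. \<lbrakk>2 \<le> r; r \<le> int n - 2\<rbrakk> \<Longrightarrow>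
            sin (real k * real_of_int r * pi / real n) * sin (pi / real n) *
              cos (real k * pi / real n) * cos (real_of_int r * pi / real n) \<noteq>
            cos (real k * real_of_int r * pi / real n) * cos (pi / real n) *
              sin (real k * pi / real n) * sin (real_of_int r * pi / real n)"
  shows "trivial_inf_deformation n (regular_polygon n) U"
proof -
  define J :: "nat \<Rightarrow> real ^ 2"
    where "J i = vector [- (regular_polygon n i $ 2), regular_polygon n i $ 1]" for i
  \<comment> \<open>Components of \<open>U\<close> in the orthonormal frame of the vertex and its
    right-angle rotation; reducing the index makes them periodic.\<close>
  define x where "x i = U (i mod n) \<bullet> regular_polygon n (i mod n)" for i
  define y where "y i = U (i mod n) \<bullet> J (i mod n)" for i
  have per: "x (i mod n) = x i" "y (i mod n) = y i" for i
    by (simp_all add: x_def y_def)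
  have U: "U i = polar_field n x y i" if "i < n" for i
  proof -
    define c s where "c = cos (2 * pi * real i / real n)" and "s = sin (2 * pi * real i / real n)"
    have "c * c + s * s = 1"
      by (simp add: c_def s_def flip: power2_eq_square)
    moreover have "x i = U i $ 1 * c + U i $ 2 * s" "y i = - U i $ 1 * s + U i $ 2 * c"
      using that by (simp_all add: x_def y_def J_def c_def s_def inner_vec_def sum_2)
    ultimately show ?thesis
      unfolding polar_field_def regular_polygon_def c_def[symmetric] s_def[symmetric]
      by (simp add: vec_eq_iff forall_2) algebra
  qed
  have "(\<forall>i<n. chord_rate n x y 1 i = 0) \<and> (\<exists>c. \<forall>i<n. chord_rate n x y k i = c)"
    using bicycle_inf_deformation_regular_iff[of n k x y U] assms per U by simp
  then obtain c where rates: "\<And>i. i < n \<Longrightarrow> chord_rate n x y 1 i = 0"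
      "\<And>i. i < n \<Longrightarrow> chord_rate n x y k i = c"
    by blast
  have side: "of_real (sin (pi / n) * cos (of_int r * pi / n)) * dft n x r +
      \<i> * of_real (cos (pi / n) * sin (of_int r * pi / n)) * dft n y r = 0" for r
  proof -
    have "dft n (chord_rate n x y 1) r = 0"
      using rates(1) by (simp add: dft_def)
    then show ?thesis
      using assms(1) per by (subst (asm) dft_chord_rate) auto
  qed
  have diagonal: "of_real (sin (k * pi / n) * cos (k * of_int r * pi / n)) * dft n x r +
      \<i> * of_real (cos (k * pi / n) * sin (k * of_int r * pi / n)) * dft n y r = 0"
    if "\<not> int n dvd r" for r
  proof -
    have "dft n (chord_rate n x y k) r = dft n (\<lambda>_. c) r"
      using rates(2) by (simp add: dft_def)
    also have "\<dots> = 0"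
      using assms(1) that by (intro dft_const) auto
    finally show ?thesis
      using assms(1) per by (subst (asm) dft_chord_rate) auto
  qed
  have "sin (pi / n) > 0" "cos (pi / n) > 0"
    using assms(1) by (auto intro!: sin_gt_zero cos_gt_zero simp: field_simps)
  show ?thesis
  proof (rule trivial_of_dft[OF \<open>4 \<le> n\<close> U])
    \<comment> \<open>At frequency 0 the coefficient of \<open>dft n y\<close> in the side equation
      vanishes.\<close>
    show "dft n x 0 = 0"
      using side[of 0] \<open>sin (pi / n) > 0\<close> by simp
    \<comment> \<open>At frequency 1 both coefficients of the side equation equal
      \<open>sin (pi / n) * cos (pi / n)\<close>, up to the factor \<open>\<i>\<close>.\<close>
    have "dft n x 1 + \<i> * dft n y 1 = 0"
    proof -
      have "of_real (sin (pi / n) * cos (pi / n)) * (dft n x 1 + \<i> * dft n y 1) = 0"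
        using side[of 1] by (simp add: algebra_simps)
      then show ?thesis
        using \<open>sin (pi / n) > 0\<close> \<open>cos (pi / n) > 0\<close> by simp
    qed
    then have "\<i> * (dft n x 1 + \<i> * dft n y 1) = 0" by simp
    then show "dft n y 1 = \<i> * dft n x 1"
      by (simp add: algebra_simps)
  next
    fix r assume r: "2 \<le> r" "r \<le> int n - 2"
    then have "\<not> int n dvd r"
      using zdvd_not_zless[of r "int n"] by auto
    define p q p' q' where "p = sin (pi / n) * cos (of_int r * pi / n)"
      and "q = cos (pi / n) * sin (of_int r * pi / n)"
      and "p' = sin (k * pi / n) * cos (k * of_int r * pi / n)"
      and "q' = cos (k * pi / n) * sin (k * of_int r * pi / n)"
    have "p * q' - p' * q \<noteq> 0"
      using det[OF r] by (simp add: p_def q_def p'_def q'_def mult_ac)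
    then have D: "complex_of_real p * of_real q' - of_real p' * of_real q \<noteq> 0"
      by (metis of_real_diff of_real_eq_0_iff of_real_mult)
    have e: "of_real p * dft n x r + \<i> * of_real q * dft n y r = 0"
        "of_real p' * dft n x r + \<i> * of_real q' * dft n y r = 0"
      using side[of r] diagonal[OF \<open>\<not> int n dvd r\<close>] by (simp_all only: p_def q_def p'_def q'_def)
    \<comment> \<open>Cramer's rule for the unknowns \<open>dft n x r\<close> and
      \<open>\<i> * dft n y r\<close>.\<close>
    have "(of_real p * of_real q' - of_real p' * of_real q) * dft n x r = 0"
      using e by algebra
    moreover have "(of_real p * of_real q' - of_real p' * of_real q) * (\<i> * dft n y r) = 0"
      using e by algebra
    ultimately show "dft n x r = 0 \<and> dft n y r = 0"
      using D by simp
  qed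
qed

text \<open>The witness is a real wave of frequency \<open>r\<close> whose amplitudes solve the side
  equation; the vanishing determinant makes them solve the diagonal equation too.\<close>

lemma nontrivial_of_determinant_zero:
  fixes n k :: nat and r :: int
  assumes "4 \<le> n" "0 < k" "k < n" and r: "2 \<le> r" "r \<le> int n - 2"
    and det: "sin (real k * real_of_int r * pi / real n) * sin (pi / real n) *
              cos (real k * pi / real n) * cos (real_of_int r * pi / real n) =
            cos (real k * real_of_int r * pi / real n) * cos (pi / real n) *
              sin (real k * pi / real n) * sin (real_of_int r * pi / real n)"
  shows "\<exists>U. bicycle_inf_deformation n k (regular_polygon n) U \<and>
              \<not> trivial_inf_deformation n (regular_polygon n) U"
proof -
  define t where "t = of_int r * pi / n"
  \<comment> \<open>Chosen so that
    \<open>sin (pi / n) * cos t * p + cos (pi / n) * sin t * q = 0\<close>.\<close>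
  define p q where "p = cos (pi / n) * sin t" and "q = - sin (pi / n) * cos t"
  define x where "x i = p * cos (2 * t * real i)" for i :: nat
  define y where "y i = q * sin (2 * t * real i)" for i :: nat
  have "cos (pi / n) > 0"
    using assms(1) by (auto intro!: cos_gt_zero simp: field_simps)
  moreover have "t < pi"
    using r(2) assms(1) by (simp add: t_def field_simps)
  then have "sin t > 0"
    using r(1) assms(1) by (intro sin_gt_zero) (simp_all add: t_def)
  ultimately have "p \<noteq> 0"
    by (simp add: p_def)
  have cis_per: "cis (2 * t * real (i mod n)) = cis (2 * t * real i)" for i
  proof -
    have "real i = real (i div n) * real n + real (i mod n)"
      by (metis div_mult_mod_eq of_nat_add of_nat_mult)
    then have "2 * t * real i = 2 * t * real (i mod n) + 2 * pi * of_int (r * int (i div n))"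
      using assms(1) by (simp add: t_def field_simps)
    then show ?thesis
      by (rule cis_cong_2pi[symmetric])
  qed
  have per: "x (i mod n) = x i" "y (i mod n) = y i" for i
    using cis_per[of i] by (auto simp: x_def y_def complex_eq_iff)
  have rate: "chord_rate n x y m i = 2 * cos (t * (2 * real i + real m)) *
      (sin (m * pi / n) * cos (m * t) * p + cos (m * pi / n) * sin (m * t) * q)" for m i
  proof -
    \<comment> \<open>The phase halfway along the chord; its ends have phases
      \<open>u + m * t\<close> and \<open>u - m * t\<close>.\<close>
    define u where "u = t * (2 * real i + real m)"
    have eqs: "2 * t * real (i + m) = u + m * t" "2 * t * real i = u - m * t"
      by (simp_all add: u_def algebra_simps)
    show ?thesis
      unfolding chord_rate_def x_def y_def eqs u_def[symmetric] cos_add cos_diff sin_add sin_diff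
      by (simp add: algebra_simps)
  qed
  have "chord_rate n x y 1 i = 0" for i
    unfolding rate by (simp add: p_def q_def)
  moreover have "chord_rate n x y k i = 0" for i
    unfolding rate using det by (simp add: p_def q_def t_def mult_ac)
  ultimately have "bicycle_inf_deformation n k (regular_polygon n) (polar_field n x y)"
    using bicycle_inf_deformation_regular_iff[of n k x y "polar_field n x y"] assms per by auto
  moreover have "\<not> trivial_inf_deformation n (regular_polygon n) (polar_field n x y)"
  proof
    assume "trivial_inf_deformation n (regular_polygon n) (polar_field n x y)"
    then obtain a b where ab: "\<And>i. i < n \<Longrightarrow>
        x i = a * cos (2 * pi * real i / real n) + b * sin (2 * pi * real i / real n)"
      by (rule trivial_polar_field_radial) blast
    have "a = p"
      using ab[of 0] assms(1) by (simp add: x_def)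
    \<comment> \<open>The indices 1 and \<open>n - 1\<close> mirror each other, so comparing the
      values of \<open>x\<close> there eliminates \<open>b\<close>.\<close>
    have last: "2 * t * real (n - 1) = - (2 * t) + 2 * pi * of_int r"
        "2 * pi * real (n - 1) / n = - (2 * pi / n) + 2 * pi"
      using assms(1) by (simp_all add: t_def of_nat_diff field_simps)
    have "x (n - 1) = p * cos (2 * t)"
    proof -
      have "cis (2 * t * real (n - 1)) = cis (- (2 * t))"
        by (rule cis_cong_2pi[OF last(1)])
      then show ?thesis
        by (simp add: x_def complex_eq_iff)
    qed
    moreover have "x (n - 1) = a * cos (2 * pi / n) - b * sin (2 * pi / n)"
      using ab[of "n - 1"] assms(1) unfolding last(2) by simp
    moreover have "p * cos (2 * t) = a * cos (2 * pi / n) + b * sin (2 * pi / n)"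
      using ab[of 1] assms(1) by (simp add: x_def)
    ultimately have "p * cos (2 * t) = p * cos (2 * (pi / n))"
      using \<open>a = p\<close> by (simp only: times_divide_eq_right)
    then have "cos (2 * t) = cos (2 * (pi / n))"
      using \<open>p \<noteq> 0\<close> by (simp only: mult_cancel_left simp_thms)
    then have "(sin t)\<^sup>2 = (sin (pi / n))\<^sup>2"
      unfolding cos_double_sin by simp
    \<comment> \<open>The bounds on \<open>r\<close> place \<open>t\<close> strictly between
      \<open>pi / n\<close> and \<open>pi - pi / n\<close>, which contradicts the equality of the
      squared sines.\<close>
    moreover have "sin (pi / n) < sin t"
    proof -
      have "sin t - sin (pi / n) = 2 * sin ((t - pi / n) / 2) * cos ((t + pi / n) / 2)"
        by (rule sin_diff_sin)
      moreover have "sin ((t - pi / n) / 2) > 0"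
      proof (rule sin_gt_zero)
        show "0 < (t - pi / n) / 2"
          using r(1) assms(1) by (simp add: t_def field_simps)
        have "(t - u) / 2 < pi" if "0 < u" for u
          using that \<open>t < pi\<close> pi_gt_zero by argo
        then show "(t - pi / n) / 2 < pi"
          using assms(1) by simp
      qed
      moreover have "cos ((t + pi / n) / 2) > 0"
      proof (rule cos_gt_zero)
        have "(of_int r + 1) * pi < n * pi"
          using r(2) by (intro mult_strict_right_mono) auto
        then show "(t + pi / n) / 2 < pi / 2"
          using assms(1) by (simp add: t_def field_simps)
        show "0 < (t + pi / n) / 2"
          using r assms(1) by (simp add: t_def add_pos_pos)
      qed
      ultimately show ?thesis
        by (metis diff_gt_0_iff_gt mult_pos_pos zero_less_numeral)
    qed
    moreover have "sin (pi / n) \<ge> 0"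
      using assms(1) by (intro sin_ge_zero) (auto simp: field_simps)
    ultimately show False
      using power_strict_mono[of "sin (pi / n)" "sin t" 2] by simp
  qed
  ultimately show ?thesis by blast
qed

theorem theorem11:
  fixes n k :: nat
  assumes "2 \<le> k" and "real k \<le> real n / 2"
  shows "(\<exists>U. bicycle_inf_deformation n k (regular_polygon n) U \<and>
              \<not> trivial_inf_deformation n (regular_polygon n) U) \<longleftrightarrow>
         (\<exists>r::int. 2 \<le> r \<and> r \<le> int n - 2 \<and>
            sin (real k * real_of_int r * pi / real n) * sin (pi / real n) *
              cos (real k * pi / real n) * cos (real_of_int r * pi / real n) =
            cos (real k * real_of_int r * pi / real n) * cos (pi / real n) *
              sin (real k * pi / real n) * sin (real_of_int r * pi / real n))"
proof -
  have "4 \<le> n" "0 < k" "k < n"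
    using assms by linarith+
  then show ?thesis
    using trivial_of_determinants_nonzero[of n k] nontrivial_of_determinant_zero[of n k] by metis
qed

end
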